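(* (Soundness of $\mathsf{NQGL}$.) For every formula $\phi$, if $\vdash_{\mathsf{NQGL}}\phi$ then $\mathfrak{BL}\models\phi$.
   Context: Formulas are built from a countable set $\mathcal{V}$ of variables, constants $\top,\bot$, atomic formulas $P(x_1,\ldots,x_n)$ for countably many $n$-ary predicate symbols ($n\in\mathbb{N}$), connectives $\land,\neg,\supset$, the quantifier $\forall$, and the modal operator $\Box$ (no function or constant symbols). $\Diamond$ abbreviates $\neg\Box\neg$, $\Diamond^n$ is $n$-fold $\Diamond$; for a set $S$ of formulas, $\Box S=\{\Box\phi\mid\phi\in S\}$. The system $\mathsf{NQGL}$: a sequent $\Gamma\rightarrow\Delta$ is a pair of finite sets of formulas. Axioms: $p\rightarrow p$ ($p$ atomic), $\rightarrow\top$, $\bot\rightarrow$. Rules: (Set) from $\Gamma\rightarrow\Delta$ infer $\Gamma'\rightarrow\Delta'$ when $\Gamma\subseteq\Gamma'$, $\Delta\subseteq\Delta'$; (Cut) from $\Gamma\rightarrow\Delta,\phi$ and $\phi,\Lambda\rightarrow\Xi$ infer $\Gamma,\Lambda\rightarrow\Delta,\Xi$; (Conjunction) from $\Gamma\rightarrow\Delta,\phi$ and $\Gamma\rightarrow\Delta,\psi$ infer $\Gamma\rightarrow\Delta,\phi\land\psi$; from $\phi,\Gamma\rightarrow\Delta$ (or from $\psi,\Gamma\rightarrow\Delta$) infer $\phi\land\psi,\Gamma\rightarrow\Delta$; (Implication) from $\phi,\Gamma\rightarrow\Delta,\psi$ infer $\Gamma\rightarrow\Delta,\phi\supset\psi$;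 from $\Gamma\rightarrow\Delta,\phi$ and $\psi,\Lambda\rightarrow\Xi$ infer $\phi\supset\psi,\Gamma,\Lambda\rightarrow\Delta,\Xi$; (Negation) from $\phi,\Gamma\rightarrow\Delta$ infer $\Gamma\rightarrow\Delta,\neg\phi$; from $\Gamma\rightarrow\Delta,\phi$ infer $\neg\phi,\Gamma\rightarrow\Delta$; (For all) from $\Gamma\rightarrow\Delta,\phi[y/x]$ infer $\Gamma\rightarrow\Delta,\forall x\phi$, where $y$ does not occur in any formula of the lower sequent; from $\phi[z/x],\Gamma\rightarrow\Delta$ infer $\forall x\phi,\Gamma\rightarrow\Delta$ for any variable $z$; (Box) from $\Box\Gamma,\Delta\rightarrow\phi$ infer $\Box\Gamma,\Box\Delta\rightarrow\Box\phi$; (Boundedness of length) from the countably many premises $\Gamma\rightarrow\Delta,\Diamond^n\top$ for all $n\in\mathbb{N}$ infer $\Gamma\rightarrow\Delta$. Derivations may be infinitary (well-founded trees). $\vdash_{\mathsf{NQGL}}\phi$ means $\rightarrow\phi$ is derivable. Semantics: a Kripke frame is $(W,R)$ with $W\neq\emptyset$, $R\subseteq W\times W$; a Kripke model over it is $(W,R,D,I)$ where $(D_w)_{w\in W}$ are non-empty domains with $D_{w_1}\subseteq D_{w_2}$ whenever $(w_1,w_2)\in R$, and $I(w,P)\subseteq (D_w)^n$ for $n$-ary $P$. Truth at a world is classical, with $\forall x$ ranging over $D_w$ and $\Box\phi$ true at $w$ iff $\phi$ is true at every $R$-successor of $w$. A non-closed formula is valid iff its universal closure is; $F\models\phi$ means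 $\phi$ is true at every world of every model over $F$; $\mathfrak{BL}\models\phi$ means $F\models\phi$ for every $F\in\mathfrak{BL}$, where $\mathfrak{BL}$ is the class of transitive Kripke frames $(W,R)$ of bounded length, i.e. for every $w\in W$ the supremum of the lengths $n$ of $R$-paths $w=w_0Rw_1R\cdots Rw_n$ is finite. *)

theory Defs
  imports "HOL-Library.FSet" "HOL-Library.Extended_Nat"
begin

section \<open>Syntax\<close>

type_synonym var = nat

text \<open>\<open>Atom i xs\<close> applies the \<open>i\<close>-th predicate symbol of arity \<open>length xs\<close>: a predicate symbol
  is a pair of an arity and an index, so there are countably many symbols of every arity
  (including 0) and every atom is well-formed.\<close>

datatype fm =
    Top
  | Bot
  | Atom nat "var list"
  | Conj fm fm
  | Neg fm
  | Imp fm fm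
  | Forall var fm
  | Box fm

abbreviation Dia :: "fm \<Rightarrow> fm" where
  "Dia \<phi> \<equiv> Neg (Box (Neg \<phi>))"

fun is_atom :: "fm \<Rightarrow> bool" where
  "is_atom (Atom i xs) = True"
| "is_atom _ = False"

primrec fv :: "fm \<Rightarrow> var set" where
  "fv Top = {}"
| "fv Bot = {}"
| "fv (Atom i xs) = set xs"
| "fv (Conj \<phi> \<psi>) = fv \<phi> \<union> fv \<psi>"
| "fv (Neg \<phi>) = fv \<phi>"
| "fv (Imp \<phi> \<psi>) = fv \<phi> \<union> fv \<psi>"
| "fv (Forall x \<phi>) = fv \<phi> - {x}"
| "fv (Box \<phi>) = fv \<phi>"

text \<open>All variables occurring in a formula, whether free, bound or in a quantifier prefix.\<close>

primrec vars :: "fm \<Rightarrow> var set" where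
  "vars Top = {}"
| "vars Bot = {}"
| "vars (Atom i xs) = set xs"
| "vars (Conj \<phi> \<psi>) = vars \<phi> \<union> vars \<psi>"
| "vars (Neg \<phi>) = vars \<phi>"
| "vars (Imp \<phi> \<psi>) = vars \<phi> \<union> vars \<psi>"
| "vars (Forall x \<phi>) = insert x (vars \<phi>)"
| "vars (Box \<phi>) = vars \<phi>"

text \<open>Simultaneous capture-avoiding renaming of the free variables. A bound variable is kept
  unless it would capture the image of a free variable; only then is it replaced, by the least
  variable that captures nothing.\<close>

primrec rename :: "(var \<Rightarrow> var) \<Rightarrow> fm \<Rightarrow> fm" where
  "rename \<sigma> Top = Top"
| "rename \<sigma> Bot = Bot"
| "rename \<sigma> (Atom i xs) = Atom i (map \<sigma> xs)"
| "rename \<sigma> (Conj \<phi> \<psi>) = Conj (rename \<sigma> \<phi>) (rename \<sigma> \<psi>)"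
| "rename \<sigma> (Neg \<phi>) = Neg (rename \<sigma> \<phi>)"
| "rename \<sigma> (Imp \<phi> \<psi>) = Imp (rename \<sigma> \<phi>) (rename \<sigma> \<psi>)"
| "rename \<sigma> (Forall x \<phi>) =
     (let C = \<sigma> ` (fv \<phi> - {x});
          x' = (if x \<in> C then LEAST y. y \<notin> C else x)
      in Forall x' (rename (\<sigma>(x := x')) \<phi>))"
| "rename \<sigma> (Box \<phi>) = Box (rename \<sigma> \<phi>)"

text \<open>\<open>\<phi>\<langle>y/x\<rangle>\<close> is \<open>\<phi>\<close> with \<open>y\<close> put for the free occurrences of \<open>x\<close>.\<close>

definition subst :: "fm \<Rightarrow> var \<Rightarrow> var \<Rightarrow> fm" ("_\<langle>_'/_\<rangle>" [1000, 1000, 1000] 1000) where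
  "\<phi>\<langle>y/x\<rangle> = rename (id(x := y)) \<phi>"

definition univ_closure :: "fm \<Rightarrow> fm" where
  "univ_closure \<phi> = foldr Forall (sorted_list_of_set (fv \<phi>)) \<phi>"


section \<open>The sequent calculus NQGL\<close>

text \<open>The rule \<open>bounded\<close> has one premise for every natural number, so derivations are
  well-founded trees that may branch infinitely.\<close>

inductive NQGL :: "fm fset \<Rightarrow> fm fset \<Rightarrow> bool" (infix "\<turnstile>" 40) where
  ax_atom: "is_atom p \<Longrightarrow> {|p|} \<turnstile> {|p|}"
| ax_top: "{||} \<turnstile> {|Top|}"
| ax_bot: "{|Bot|} \<turnstile> {||}"
| set: "\<Gamma> \<turnstile> \<Delta> \<Longrightarrow> \<Gamma> |\<subseteq>| \<Gamma>' \<Longrightarrow> \<Delta> |\<subseteq>| \<Delta>' \<Longrightarrow> \<Gamma>' \<turnstile> \<Delta>'"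
| cut: "\<Gamma> \<turnstile> finsert \<phi> \<Delta> \<Longrightarrow> finsert \<phi> \<Lambda> \<turnstile> \<Xi> \<Longrightarrow> \<Gamma> |\<union>| \<Lambda> \<turnstile> \<Delta> |\<union>| \<Xi>"
| conj_right: "\<Gamma> \<turnstile> finsert \<phi> \<Delta> \<Longrightarrow> \<Gamma> \<turnstile> finsert \<psi> \<Delta> \<Longrightarrow> \<Gamma> \<turnstile> finsert (Conj \<phi> \<psi>) \<Delta>"
| conj_left1: "finsert \<phi> \<Gamma> \<turnstile> \<Delta> \<Longrightarrow> finsert (Conj \<phi> \<psi>) \<Gamma> \<turnstile> \<Delta>"
| conj_left2: "finsert \<psi> \<Gamma> \<turnstile> \<Delta> \<Longrightarrow> finsert (Conj \<phi> \<psi>) \<Gamma> \<turnstile> \<Delta>"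
| imp_right: "finsert \<phi> \<Gamma> \<turnstile> finsert \<psi> \<Delta> \<Longrightarrow> \<Gamma> \<turnstile> finsert (Imp \<phi> \<psi>) \<Delta>"
| imp_left: "\<Gamma> \<turnstile> finsert \<phi> \<Delta> \<Longrightarrow> finsert \<psi> \<Lambda> \<turnstile> \<Xi> \<Longrightarrow>
    finsert (Imp \<phi> \<psi>) (\<Gamma> |\<union>| \<Lambda>) \<turnstile> \<Delta> |\<union>| \<Xi>"
| neg_right: "finsert \<phi> \<Gamma> \<turnstile> \<Delta> \<Longrightarrow> \<Gamma> \<turnstile> finsert (Neg \<phi>) \<Delta>"
| neg_left: "\<Gamma> \<turnstile> finsert \<phi> \<Delta> \<Longrightarrow> finsert (Neg \<phi>) \<Gamma> \<turnstile> \<Delta>"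
| forall_right: "\<Gamma> \<turnstile> finsert (\<phi>\<langle>y/x\<rangle>) \<Delta> \<Longrightarrow>
    \<forall>\<psi>. \<psi> |\<in>| \<Gamma> |\<union>| finsert (Forall x \<phi>) \<Delta> \<longrightarrow> y \<notin> vars \<psi> \<Longrightarrow>
    \<Gamma> \<turnstile> finsert (Forall x \<phi>) \<Delta>"
| forall_left: "finsert (\<phi>\<langle>z/x\<rangle>) \<Gamma> \<turnstile> \<Delta> \<Longrightarrow> finsert (Forall x \<phi>) \<Gamma> \<turnstile> \<Delta>"
| box: "(Box |`| \<Gamma>) |\<union>| \<Delta> \<turnstile> {|\<phi>|} \<Longrightarrow> (Box |`| \<Gamma>) |\<union>| (Box |`| \<Delta>) \<turnstile> {|Box \<phi>|}"
| bounded: "(\<And>n. \<Gamma> \<turnstile> finsert ((Dia ^^ n) Top) \<Delta>) \<Longrightarrow> \<Gamma> \<turnstile> \<Delta>"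

abbreviation NQGL_provable :: "fm \<Rightarrow> bool" ("\<turnstile>\<^sub>N\<^sub>Q\<^sub>G\<^sub>L _" [40] 40) where
  "\<turnstile>\<^sub>N\<^sub>Q\<^sub>G\<^sub>L \<phi> \<equiv> {||} \<turnstile> {|\<phi>|}"


section \<open>Kripke semantics\<close>

type_synonym 'w frame = "'w set \<times> ('w \<times> 'w) set"

definition kripke_frame :: "'w frame \<Rightarrow> bool" where
  "kripke_frame F \<longleftrightarrow> (case F of (W, R) \<Rightarrow> W \<noteq> {} \<and> R \<subseteq> W \<times> W)"

text \<open>\<open>I w n i\<close> interprets, at world \<open>w\<close>, the \<open>i\<close>-th predicate symbol of arity \<open>n\<close>;
  \<open>n\<close>-tuples are lists of length \<open>n\<close>.\<close>

definition kripke_model ::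
    "'w frame \<Rightarrow> ('w \<Rightarrow> 'd set) \<Rightarrow> ('w \<Rightarrow> nat \<Rightarrow> nat \<Rightarrow> 'd list set) \<Rightarrow> bool" where
  "kripke_model F D I \<longleftrightarrow> kripke_frame F \<and> (case F of (W, R) \<Rightarrow>
     (\<forall>w\<in>W. D w \<noteq> {}) \<and>
     (\<forall>(w\<^sub>1, w\<^sub>2)\<in>R. D w\<^sub>1 \<subseteq> D w\<^sub>2) \<and>
     (\<forall>w\<in>W. \<forall>n i. I w n i \<subseteq> {ds. length ds = n \<and> set ds \<subseteq> D w}))"

primrec holds ::
    "('w \<times> 'w) set \<Rightarrow> ('w \<Rightarrow> 'd set) \<Rightarrow> ('w \<Rightarrow> nat \<Rightarrow> nat \<Rightarrow> 'd list set) \<Rightarrow>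
     fm \<Rightarrow> 'w \<Rightarrow> (var \<Rightarrow> 'd) \<Rightarrow> bool" where
  "holds R D I Top w v \<longleftrightarrow> True"
| "holds R D I Bot w v \<longleftrightarrow> False"
| "holds R D I (Atom i xs) w v \<longleftrightarrow> map v xs \<in> I w (length xs) i"
| "holds R D I (Conj \<phi> \<psi>) w v \<longleftrightarrow> holds R D I \<phi> w v \<and> holds R D I \<psi> w v"
| "holds R D I (Neg \<phi>) w v \<longleftrightarrow> \<not> holds R D I \<phi> w v"
| "holds R D I (Imp \<phi> \<psi>) w v \<longleftrightarrow> (holds R D I \<phi> w v \<longrightarrow> holds R D I \<psi> w v)"
| "holds R D I (Forall x \<phi>) w v \<longleftrightarrow> (\<forall>d\<in>D w. holds R D I \<phi> w (v(x := d)))"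
| "holds R D I (Box \<phi>) w v \<longleftrightarrow> (\<forall>w'. (w, w') \<in> R \<longrightarrow> holds R D I \<phi> w' v)"

text \<open>Validity of a formula on a frame is validity of its universal closure. The closure has no
  free variables, so the assignment \<open>v\<close> is immaterial. Worlds and individuals are elements of
  arbitrary types, recorded by the \<open>itself\<close> arguments; those types serve only as universes,
  since the set of worlds and the domains may be any nonempty subsets of them.\<close>

definition frame_valid :: "'d itself \<Rightarrow> 'w frame \<Rightarrow> fm \<Rightarrow> bool" where
  "frame_valid d F \<phi> \<longleftrightarrow>
     (\<forall>(D :: 'w \<Rightarrow> 'd set) I. kripke_model F D I \<longrightarrow>
       (\<forall>w\<in>fst F. \<forall>v. range v \<subseteq> D w \<longrightarrow> holds (snd F) D I (univ_closure \<phi>) w v))"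

text \<open>The supremum of the lengths of the paths that start at \<open>w\<close>.\<close>

definition height :: "('w \<times> 'w) set \<Rightarrow> 'w \<Rightarrow> enat" where
  "height R w = (SUP n\<in>{n. \<exists>u. (w, u) \<in> R ^^ n}. enat n)"

definition BL :: "'w frame set" where
  "BL = {(W, R). kripke_frame (W, R) \<and> trans R \<and> (\<forall>w\<in>W. height R w < \<infinity>)}"

definition BL_valid :: "'w itself \<Rightarrow> 'd itself \<Rightarrow> fm \<Rightarrow> bool" where
  "BL_valid w d \<phi> \<longleftrightarrow> (\<forall>F\<in>(BL :: 'w frame set). frame_valid d F \<phi>)"

end

theory Submission
  imports Defs
begin

text \<open>Every rule preserves truth, at a fixed world \<open>w\<close>, under all assignments into the domain of
  \<open>w\<close>. Since the domains grow along the accessibility relation, such an assignment remains one at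
  all successors, so (Box) is sound by transitivity. In (Boundedness of length), a refutation of the
  conclusion at \<open>w\<close> would make every \<open>\<Diamond>\<^sup>n\<top>\<close> true at \<open>w\<close>, giving paths of all lengths from \<open>w\<close>.\<close>

lemma finite_fv: "finite (fv \<phi>)"
  by (induction \<phi>) auto

lemma fv_subset_vars: "fv \<phi> \<subseteq> vars \<phi>"
  by (induction \<phi>) auto

lemma holds_cong_fv:
  assumes "\<And>x. x \<in> fv \<phi> \<Longrightarrow> u x = v x"
  shows "holds R D I \<phi> w u \<longleftrightarrow> holds R D I \<phi> w v"
  using assms
proof (induction \<phi> arbitrary: w u v)
  case (Atom i xs)
  then have "map u xs = map v xs" by simp
  then show ?case by (simp only: holds.simps)
next
  case (Conj \<phi> \<psi>)
  from Conj.IH(1)[of u v] Conj.IH(2)[of u v] Conj.prems show ?case by simp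
next
  case (Neg \<phi>)
  from Neg.IH[of u v] Neg.prems show ?case by simp
next
  case (Imp \<phi> \<psi>)
  from Imp.IH(1)[of u v] Imp.IH(2)[of u v] Imp.prems show ?case by simp
next
  case (Forall x \<phi>)
  have "holds R D I \<phi> w (u(x := d)) \<longleftrightarrow> holds R D I \<phi> w (v(x := d))" for d
    by (rule Forall.IH) (use Forall.prems in simp)
  then show ?case by simp
next
  case (Box \<phi>)
  from Box.IH[of u v] Box.prems show ?case by simp
qed simp_all

text \<open>Only the binder needs thought. The renaming stays arbitrary in the induction because it
  is updated to \<open>\<sigma>(x := x')\<close> below a quantifier.\<close>

lemma holds_rename: "holds R D I (rename \<sigma> \<phi>) w v \<longleftrightarrow> holds R D I \<phi> w (v \<circ> \<sigma>)"
proof (induction \<phi> arbitrary: \<sigma> w v)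
  case (Forall x \<phi>)
  define C where "C = \<sigma> ` (fv \<phi> - {x})"
  define x' where "x' = (if x \<in> C then LEAST y. y \<notin> C else x)"
  have "\<exists>y. y \<notin> C"
    using finite_fv[of \<phi>] by (intro ex_new_if_finite) (auto simp: C_def)
  then have x': "x' \<notin> C"
    using LeastI_ex[of "\<lambda>y. y \<notin> C"] by (simp add: x'_def)
  \<comment> \<open>At \<open>x\<close> both sides give \<open>d\<close>. Any other free variable of
    \<open>\<phi>\<close> is sent by \<open>\<sigma>\<close> into \<open>C\<close>, hence not to
    \<open>x'\<close>, so the update at \<open>x'\<close> does not reach it.\<close>
  have "holds R D I \<phi> w (v(x' := d) \<circ> \<sigma>(x := x')) \<longleftrightarrow> holds R D I \<phi> w ((v \<circ> \<sigma>)(x := d))" for d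
    by (rule holds_cong_fv) (use x' in \<open>auto simp: C_def\<close>)
  moreover have "rename \<sigma> (Forall x \<phi>) = Forall x' (rename (\<sigma>(x := x')) \<phi>)"
    by (simp add: Let_def C_def x'_def)
  ultimately show ?case
    by (simp only: holds.simps Forall.IH)
qed simp_all

lemma holds_subst: "holds R D I (\<phi>\<langle>y/x\<rangle>) w v \<longleftrightarrow> holds R D I \<phi> w (v(x := v y))"
  by (simp add: subst_def holds_rename fun_upd_comp)

lemma holds_Dia_power_Top: "holds R D I ((Dia ^^ n) Top) w v \<longleftrightarrow> (\<exists>u. (w, u) \<in> R ^^ n)"
proof (induction n arbitrary: w)
  case (Suc n)
  have "holds R D I ((Dia ^^ Suc n) Top) w v \<longleftrightarrow> (\<exists>w' u. (w, w') \<in> R \<and> (w', u) \<in> R ^^ n)"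
    by (simp add: Suc.IH)
  \<comment> \<open>The outermost diamond takes the first edge of a path, while the recursion for
    \<open>R ^^ Suc n\<close> splits off the last one.\<close>
  also have "\<dots> \<longleftrightarrow> (\<exists>u. (w, u) \<in> R ^^ Suc n)"
    by (metis relpow_Suc_D2 relpow_Suc_I2)
  finally show ?case .
qed simp

lemma height_eq_infinity:
  assumes "\<And>n. \<exists>u. (w, u) \<in> R ^^ n"
  shows "height R w = \<infinity>"
proof -
  have "enat n \<le> height R w" for n
    unfolding height_def using assms by (intro SUP_upper) simp
  \<comment> \<open>A finite height \<open>enat k\<close> would be at least
    \<open>enat (Suc k)\<close>.\<close>
  then show ?thesis
    by (metis enat_ord_simps(1) not_infinity_eq not_less_eq_eq order_refl)
qed

text \<open>One assignment is shared by all formulas of both sides, instead of closing each formula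
  separately. This lets the propositional rules and (Cut) be checked classically at a single
  world.\<close>

definition sequent_holds ::
    "('w \<times> 'w) set \<Rightarrow> ('w \<Rightarrow> 'd set) \<Rightarrow> ('w \<Rightarrow> nat \<Rightarrow> nat \<Rightarrow> 'd list set) \<Rightarrow>
     fm fset \<Rightarrow> fm fset \<Rightarrow> 'w \<Rightarrow> (var \<Rightarrow> 'd) \<Rightarrow> bool" where
  "sequent_holds R D I \<Gamma> \<Delta> w v \<longleftrightarrow>
     ((\<forall>\<phi>. \<phi> |\<in>| \<Gamma> \<longrightarrow> holds R D I \<phi> w v) \<longrightarrow> (\<exists>\<phi>. \<phi> |\<in>| \<Delta> \<and> holds R D I \<phi> w v))"

lemma soundness:
  assumes "\<Gamma> \<turnstile> \<Delta>"
    and "(W, R) \<in> BL" and model: "kripke_model (W, R) D I"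
    and "w \<in> W" and "range v \<subseteq> D w"
  shows "sequent_holds R D I \<Gamma> \<Delta> w v"
proof -
  have R: "R \<subseteq> W \<times> W" "trans R" and height: "\<And>w. w \<in> W \<Longrightarrow> height R w \<noteq> \<infinity>"
    using assms(2) by (auto simp: BL_def kripke_frame_def)
  have mono: "D w \<subseteq> D w'" if "(w, w') \<in> R" for w w'
    using model that by (auto simp: kripke_model_def)
  from assms(1,4,5) show ?thesis
  \<comment> \<open>(Box) needs its premise at the successors of \<open>w\<close>, and the right
    rule for the quantifier needs its premise under changed assignments.\<close>
  proof (induction arbitrary: w v)
    case (forall_right \<Gamma> \<phi> y x \<Delta>)
    have y: "y \<notin> fv \<psi>" if "\<psi> |\<in>| \<Gamma> \<or> \<psi> = Forall x \<phi> \<or> \<psi> |\<in>| \<Delta>" for \<psi>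
      using forall_right.hyps(2) that fv_subset_vars[of \<psi>] by blast
    have fresh: "holds R D I \<psi> w (v(y := d)) \<longleftrightarrow> holds R D I \<psi> w v"
      if "\<psi> |\<in>| \<Gamma> \<or> \<psi> |\<in>| \<Delta>" for \<psi> d
      by (rule holds_cong_fv) (use y that in auto)
    \<comment> \<open>After the update at \<open>y\<close>, the two assignments both send
      \<open>x\<close> to \<open>d\<close>. They can differ only at \<open>y\<close>, which is not
      free in \<open>Forall x \<phi>\<close>.\<close>
    have inst: "holds R D I (\<phi>\<langle>y/x\<rangle>) w (v(y := d)) \<longleftrightarrow> holds R D I \<phi> w (v(x := d))" for d
      unfolding holds_subst by (rule holds_cong_fv) (use y[of "Forall x \<phi>"] in auto)
    \<comment> \<open>The eigenvariable \<open>y\<close> serves as a name for an arbitrary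
      \<open>d\<close>; \<open>fresh\<close> then returns the side formulas to
      \<open>v\<close>.\<close>
    have "sequent_holds R D I \<Gamma> (finsert (\<phi>\<langle>y/x\<rangle>) \<Delta>) w (v(y := d))" if "d \<in> D w" for d
      by (rule forall_right.IH) (use forall_right.prems that in auto)
    then have "holds R D I \<phi> w (v(x := d)) \<or> (\<exists>\<psi>. \<psi> |\<in>| \<Delta> \<and> holds R D I \<psi> w v)"
      if "d \<in> D w" "\<forall>\<psi>. \<psi> |\<in>| \<Gamma> \<longrightarrow> holds R D I \<psi> w v" for d
      using that fresh inst unfolding sequent_holds_def by (metis finsert_iff)
    then show ?case
      unfolding sequent_holds_def by (metis finsert_iff holds.simps(7))
  next
    case (forall_left \<phi> z x \<Gamma> \<Delta>)
    \<comment> \<open>The instance at \<open>z\<close> is thus among those over which the quantifier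
      ranges at \<open>w\<close>.\<close>
    have "v z \<in> D w"
      using forall_left.prems by auto
    then show ?case
      using forall_left.IH[OF forall_left.prems] by (auto simp: sequent_holds_def holds_subst)
  next
    case (box \<Gamma> \<Delta> \<phi>)
    have "holds R D I \<phi> w' v"
      if \<Gamma>: "\<forall>\<psi>. \<psi> |\<in>| \<Gamma> \<longrightarrow> holds R D I (Box \<psi>) w v"
        and \<Delta>: "\<forall>\<psi>. \<psi> |\<in>| \<Delta> \<longrightarrow> holds R D I (Box \<psi>) w v" and ww': "(w, w') \<in> R" for w'
    proof -
      have "w' \<in> W" "range v \<subseteq> D w'"
        using ww' R(1) mono[OF ww'] box.prems by auto
      then have "sequent_holds R D I (Box |`| \<Gamma> |\<union>| \<Delta>) {|\<phi>|} w' v"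
        by (rule box.IH)
      \<comment> \<open>Successors of \<open>w'\<close> are successors of \<open>w\<close>, so a
        boxed formula true at \<open>w\<close> remains true at \<open>w'\<close>.\<close>
      moreover have "holds R D I (Box \<psi>) w' v" if "\<psi> |\<in>| \<Gamma>" for \<psi>
        using \<Gamma> that ww' \<open>trans R\<close> by (auto dest: transD)
      ultimately show ?thesis
        using \<Delta> ww' by (auto simp: sequent_holds_def)
    qed
    then show ?case
      unfolding sequent_holds_def by (metis fimageI finsertI1 funion_iff holds.simps(8))
  next
    case (bounded \<Gamma> \<Delta>)
    \<comment> \<open>The premise for this single \<open>n\<close> suffices: its added diamond
      formula is false at \<open>w\<close>, so the premise reduces to the conclusion.\<close>
    obtain n where n: "\<not> (\<exists>u. (w, u) \<in> R ^^ n)"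
      using height[OF \<open>w \<in> W\<close>] height_eq_infinity by metis
    show ?case
      using bounded.IH[OF bounded.prems, of n] n
      by (auto simp: sequent_holds_def simp flip: holds_Dia_power_Top[of R D I n w v])
  next
    case (set \<Gamma> \<Delta> \<Gamma>' \<Delta>')
    from set.IH[OF set.prems] set.hyps show ?case
      unfolding sequent_holds_def by (meson fsubsetD)
  next
    case (cut \<Gamma> \<phi> \<Delta> \<Lambda> \<Xi>)
    from cut.IH[OF cut.prems] show ?case
      unfolding sequent_holds_def by auto
  next
    case (conj_right \<Gamma> \<phi> \<Delta> \<psi>)
    from conj_right.IH[OF conj_right.prems] show ?case
      unfolding sequent_holds_def by auto
  next
    case (imp_left \<Gamma> \<phi> \<Delta> \<psi> \<Lambda> \<Xi>)
    from imp_left.IH[OF imp_left.prems] show ?case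
      unfolding sequent_holds_def by auto
  next
    case (imp_right \<phi> \<Gamma> \<psi> \<Delta>)
    from imp_right.IH[OF imp_right.prems] show ?case
      unfolding sequent_holds_def by auto
  next
    case (neg_right \<phi> \<Gamma> \<Delta>)
    from neg_right.IH[OF neg_right.prems] show ?case
      unfolding sequent_holds_def by auto
  next
    case (neg_left \<Gamma> \<phi> \<Delta>)
    from neg_left.IH[OF neg_left.prems] show ?case
      unfolding sequent_holds_def by auto
  qed (auto simp: sequent_holds_def)
qed

text \<open>All the quantifiers are evaluated at the same world \<open>w\<close>, so each update
  picks a value in \<open>D w\<close> and the assignment stays within that domain.\<close>

lemma holds_foldr_Forall:
  assumes "\<And>v. range v \<subseteq> D w \<Longrightarrow> holds R D I \<phi> w v" and "range v \<subseteq> D w"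
  shows "holds R D I (foldr Forall xs \<phi>) w v"
  using assms(2)
proof (induction xs arbitrary: v)
  case (Cons x xs)
  have "holds R D I (foldr Forall xs \<phi>) w (v(x := d))" if "d \<in> D w" for d
    by (rule Cons.IH) (use Cons.prems that in auto)
  then show ?case by simp
qed (simp add: assms(1))

theorem theorem2:
  fixes \<phi> :: fm
  assumes "\<turnstile>\<^sub>N\<^sub>Q\<^sub>G\<^sub>L \<phi>"
  shows "BL_valid TYPE('w) TYPE('d) \<phi>"
  unfolding BL_valid_def frame_valid_def univ_closure_def
proof (intro ballI allI impI)
  fix F :: "'w frame" and D :: "'w \<Rightarrow> 'd set" and I w and v :: "var \<Rightarrow> 'd"
  assume "F \<in> BL" "kripke_model F D I" "w \<in> fst F" and v: "range v \<subseteq> D w"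
  then have "sequent_holds (snd F) D I {||} {|\<phi>|} w u" if "range u \<subseteq> D w" for u
    using that by (intro soundness[OF assms, where W = "fst F"]) simp_all
  then show "holds (snd F) D I (foldr Forall (sorted_list_of_set (fv \<phi>)) \<phi>) w v"
    using v by (intro holds_foldr_Forall) (simp_all add: sequent_holds_def)
qed

end
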